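(* Let $x>1$ be the solution in $(1,\infty)$ of $x^4-2x-1=0$. Then for every $n\ge1$ and all $A,B\in\mathbb M_n(\mathbb C)$, \[ \|A+B\|_4^4\le\frac{x^2(x+1)}{2}\,\big\||A|+|B|\big\|_4^4 . \] The constant $\frac{x^2(x+1)}{2}$ is sharp in the dimension-free problem (i.e. it is the supremum of $\|A+B\|_4^4/\||A|+|B|\|_4^4$ over all $n\ge1$ and all $(A,B)\ne(0,0)$ in $\mathbb M_n(\mathbb C)^2$); for every $n\ge2$ it is attained by some $(A,B)\neq(0,0)$ in $\mathbb M_n(\mathbb C)^2$; and it equals $(C^{\mathrm{TZ}}_{4,2})^4$.
   Context: For $A\in\mathbb M_n(\mathbb C)$ (complex $n\times n$ matrices), $|A|=(A^*A)^{1/2}$, and $\|A\|_p=(\operatorname{Tr}|A|^p)^{1/p}$ is the Schatten $p$-norm for $1\le p<\infty$. For finite $p>1$ and integer $m\ge2$, let $x_{p,m}>1$ be the unique solution in $(1,\infty)$ of $x^p-2x-(m-1)=0$, and define \[ C^{\mathrm{TZ}}_{p,m}=\frac{\sqrt{x_{p,m}(x_{p,m}+m-1)}}{(x_{p,m}^p+m-1)^{1/p}}. \] In particular, $C^{\mathrm{TZ}}_{4,2}=\dfrac{\sqrt{x(x+1)}}{(x^4+1)^{1/4}}$ with $x=x_{4,2}$. *)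

theory Defs
  imports Complex_Main "Jordan_Normal_Form.Schur_Decomposition"
begin

section \<open>Functional calculus, modulus and Schatten norms of complex matrices\<close>

definition unitary_mat :: "complex mat \<Rightarrow> bool" where
  "unitary_mat U \<longleftrightarrow> square_mat U \<and> mat_adjoint U * U = 1\<^sub>m (dim_row U)"

definition unitary_conj :: "complex mat \<Rightarrow> (nat \<Rightarrow> real) \<Rightarrow> complex mat" where
  "unitary_conj U d = U * mat_diag (dim_row U) (\<lambda>i. complex_of_real (d i)) * mat_adjoint U"

text \<open>
  \<open>herm_fun f H\<close> is \<open>f(H)\<close> for Hermitian \<open>H\<close>: it is \<open>U diag(f(d\<^sub>0), \<dots>) U\<^sup>*\<close> for any unitary
  diagonalisation \<open>H = U diag(d\<^sub>0, \<dots>) U\<^sup>*\<close> with real \<open>d\<^sub>i\<close>. The value does not depend on the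
  diagonalisation (lemma \<open>herm_fun_unitary_conj\<close> below); it is unspecified if \<open>H\<close> is not Hermitian.
\<close>
definition herm_fun :: "(real \<Rightarrow> real) \<Rightarrow> complex mat \<Rightarrow> complex mat" where
  "herm_fun f H = (THE K. \<exists>U d. unitary_mat U \<and> H = unitary_conj U d \<and> K = unitary_conj U (f \<circ> d))"

text \<open>Real powers of positive semidefinite matrices; only exponents \<open>r > 0\<close> are used, for which
  \<open>0 powr r = 0\<close> is the right value on the kernel.\<close>
definition mat_powr :: "complex mat \<Rightarrow> real \<Rightarrow> complex mat" where
  "mat_powr P r = herm_fun (\<lambda>t. t powr r) P"

definition mat_abs :: "complex mat \<Rightarrow> complex mat" where
  "mat_abs A = mat_powr (mat_adjoint A * A) (1 / 2)"

definition mat_trace :: "'a :: comm_monoid_add mat \<Rightarrow> 'a" where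
  "mat_trace A = (\<Sum>i<dim_row A. A $$ (i, i))"

text \<open>The trace below is a nonnegative real number; \<open>Re\<close> only changes its type.\<close>
definition schatten_norm :: "real \<Rightarrow> complex mat \<Rightarrow> real" where
  "schatten_norm p A = Re (mat_trace (mat_powr (mat_abs A) p)) powr (1 / p)"

section \<open>The constants\<close>

definition tz_root :: "real \<Rightarrow> nat \<Rightarrow> real" where
  "tz_root p m = (THE x. 1 < x \<and> x powr p - 2 * x - (real m - 1) = 0)"

definition tz_const :: "real \<Rightarrow> nat \<Rightarrow> real" where
  "tz_const p m = (let x = tz_root p m in
     sqrt (x * (x + real m - 1)) / (x powr p + real m - 1) powr (1 / p))"

section \<open>Well-definedness\<close>

lemma mat_adjoint_carrier [simp]:
  "A \<in> carrier_mat n m \<Longrightarrow> mat_adjoint A \<in> carrier_mat m n"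
  unfolding mat_adjoint_def by auto

lemma herm_fun_unitary_conj:
  assumes "unitary_mat U"
  shows "herm_fun f (unitary_conj U d) = unitary_conj U (f \<circ> d)"
  unfolding herm_fun_def
proof (rule the_equality)
  show "\<exists>V e. unitary_mat V \<and> unitary_conj U d = unitary_conj V e
      \<and> unitary_conj U (f \<circ> d) = unitary_conj V (f \<circ> e)"
    using assms by blast
next
  fix K
  assume "\<exists>V e. unitary_mat V \<and> unitary_conj U d = unitary_conj V e \<and> K = unitary_conj V (f \<circ> e)"
  then obtain V e where V: "unitary_mat V" and eq: "unitary_conj U d = unitary_conj V e"
    and K: "K = unitary_conj V (f \<circ> e)" by blast
  define n where "n = dim_row U"
  have "dim_row V = n"
    using arg_cong[OF eq, of dim_row] by (simp add: unitary_conj_def n_def)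
  with assms V have U: "U \<in> carrier_mat n n" and V': "V \<in> carrier_mat n n"
    and UU: "mat_adjoint U * U = 1\<^sub>m n" and VV: "mat_adjoint V * V = 1\<^sub>m n"
    by (auto simp: unitary_mat_def n_def)
  define Us Vs where "Us = mat_adjoint U" and "Vs = mat_adjoint V"
  have Us: "Us \<in> carrier_mat n n" and Vs: "Vs \<in> carrier_mat n n"
    using U V' by (simp_all add: Us_def Vs_def)
  have UU: "Us * U = 1\<^sub>m n" and VV: "Vs * V = 1\<^sub>m n"
    using UU VV by (simp_all add: Us_def Vs_def)
  have UU': "U * Us = 1\<^sub>m n" by (rule mat_mult_left_right_inverse[OF Us U UU])
  have VV': "V * Vs = 1\<^sub>m n" by (rule mat_mult_left_right_inverse[OF Vs V' VV])
  define D where "D g = mat_diag n (\<lambda>i. complex_of_real (g i))" for g :: "nat \<Rightarrow> real"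
  have D: "D g \<in> carrier_mat n n" for g by (simp add: D_def)
  have cU: "unitary_conj U g = U * D g * Us" for g
    by (simp add: unitary_conj_def D_def n_def Us_def)
  have cV: "unitary_conj V g = V * D g * Vs" for g
    by (simp add: unitary_conj_def D_def \<open>dim_row V = n\<close> Vs_def)
  note [simp] = U V' Us Vs D
  note as = assoc_mult_mat[of _ n n _ n _ n]
  define W where "W = Vs * U"
  have W: "W \<in> carrier_mat n n" by (simp add: W_def mult_carrier_mat[of _ n n])
  note mc = mult_carrier_mat[of _ n n _ n]
  have "W * D d = Vs * (U * D d * Us) * U"
    by (simp add: W_def as mc UU right_mult_one_mat[of _ n n])
  also have "\<dots> = Vs * (V * D e * Vs) * U"
    using eq by (simp add: cU cV)
  also have "\<dots> = (Vs * V) * D e * W"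
    by (simp add: W_def as mc)
  also have "\<dots> = D e * W"
    by (simp add: VV left_mult_one_mat[of _ n n])
  finally have WD: "W * D d = D e * W" .
  have "W * D (f \<circ> d) = D (f \<circ> e) * W"
  proof (rule eq_matI)
    fix i j
    assume "i < dim_row (D (f \<circ> e) * W)" "j < dim_col (D (f \<circ> e) * W)"
    then have ij: "i < n" "j < n" using W by (auto simp: D_def mat_diag_def)
    have "W $$ (i, j) * complex_of_real (d j) = complex_of_real (e i) * W $$ (i, j)"
      using arg_cong[OF WD, of "\<lambda>M. M $$ (i, j)"] ij
      by (simp add: D_def mat_diag_mult_left[OF W] mat_diag_mult_right[OF W])
    then have "W $$ (i, j) = 0 \<or> d j = e i" by auto
    then show "(W * D (f \<circ> d)) $$ (i, j) = (D (f \<circ> e) * W) $$ (i, j)"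
      using ij by (auto simp: D_def mat_diag_mult_left[OF W] mat_diag_mult_right[OF W])
  qed (use W in \<open>auto simp: D_def mat_diag_def\<close>)
  note WF = this
  have "unitary_conj U (f \<circ> d) = (V * Vs) * U * D (f \<circ> d) * Us"
    by (simp add: cU VV' left_mult_one_mat[of _ n n])
  also have "\<dots> = V * (W * D (f \<circ> d)) * Us"
    by (simp add: W_def as mc)
  also have "\<dots> = V * (D (f \<circ> e) * W) * Us"
    by (simp add: WF)
  also have "\<dots> = V * D (f \<circ> e) * Vs"
    by (simp add: W_def as mc UU' right_mult_one_mat[of _ n n])
  finally show "K = unitary_conj U (f \<circ> d)" by (simp add: K cV)
qed

lemma tz_root_ex1:
  fixes p :: real and m :: nat
  assumes p: "1 < p" and m: "2 \<le> m"
  shows "\<exists>!x. 1 < x \<and> x powr p - 2 * x - (real m - 1) = 0"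
proof -
  define g where "g = (\<lambda>x::real. x powr (p - 1) - 2 - (real m - 1) / x)"
  have g: "x powr p - 2 * x - (real m - 1) = x * g x" if "1 < x" for x
  proof -
    have "x powr p = x * x powr (p - 1)"
      using that powr_add[of x 1 "p - 1"] by simp
    then show ?thesis using that by (simp add: g_def field_simps)
  qed
  have mono: "g x < g y" if "1 \<le> x" "x < y" for x y
  proof -
    have "x powr (p - 1) < y powr (p - 1)"
      using that p by (intro powr_less_mono2) auto
    moreover have "(real m - 1) / y \<le> (real m - 1) / x"
      using that m by (intro divide_left_mono) auto
    ultimately show ?thesis by (simp add: g_def)
  qed
  define b where "b = (real m + 1) powr (1 / (p - 1))"
  have b1: "1 < b" using p m by (simp add: b_def gr_one_powr)
  have "b powr (p - 1) = real m + 1" using p m by (simp add: b_def powr_powr)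
  moreover have "(real m - 1) / b \<le> real m - 1"
    using b1 m divide_left_mono[of 1 b "real m - 1"] by simp
  ultimately have gb: "0 \<le> g b" by (simp add: g_def)
  have g1: "g 1 < 0" using m by (simp add: g_def)
  have "\<exists>x. 1 \<le> x \<and> x \<le> b \<and> g x = 0"
  proof (rule IVT)
    show "\<forall>x. 1 \<le> x \<and> x \<le> b \<longrightarrow> isCont g x"
      unfolding g_def by (auto intro!: continuous_intros)
  qed (use g1 gb b1 in auto)
  then obtain x where x: "1 \<le> x" "g x = 0" by blast
  with g1 have x1: "1 < x" by (cases "x = 1") auto
  show ?thesis
  proof (rule ex1I[of _ x])
    show "1 < x \<and> x powr p - 2 * x - (real m - 1) = 0"
      using x1 x g[OF x1] by simp
  next
    fix y
    assume y: "1 < y \<and> y powr p - 2 * y - (real m - 1) = 0"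
    with g[of y] have "g y = 0" by auto
    with x x1 y mono[of x y] mono[of y x] show "y = x" by (cases x y rule: linorder_cases) auto
  qed
qed

end

theory Submission
  imports Defs "HOL-Analysis.L2_Norm" "Jordan_Normal_Form.Spectral_Radius"
begin

text \<open>
  Write \<open>P = |A|\<close>, \<open>Q = |B|\<close>, so that \<open>P\<^sup>2 = A\<^sup>*A\<close> and \<open>Q\<^sup>2 = B\<^sup>*B\<close>, let \<open>p\<close>, \<open>q\<close> be the Frobenius norms of \<open>P\<^sup>2\<close>
  and \<open>Q\<^sup>2\<close>, put \<open>r\<^sup>2 = Tr P\<^sup>2Q\<^sup>2\<close>, and let \<open>c\<close> be the constant. Both sides of the inequality can be
  compared through these three numbers.

  The upper estimate \<open>gram_of_sum_norm_le\<close> bounds the fourth power of the norm of \<open>A + B\<close> by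
  \<open>2 (p\<^sup>2 + q\<^sup>2 + 2 r\<^sup>2) + 4 r (p + q)\<close>. It rests on the parallelogram law, used for one of the two factors
  \<open>(A + B)\<^sup>*(A + B)\<close> only, and on Cauchy-Schwarz. The lower estimate \<open>fourth_power_of_sum_norm_ge\<close> bounds the
  trace of \<open>(P + Q)\<^sup>4\<close> below by \<open>p\<^sup>2 + q\<^sup>2 + 12 r\<^sup>2 + 2 \<gamma>\<close> with \<open>\<gamma> p q \<ge> r\<^sup>4\<close>, by expanding it and
  comparing the mixed traces by Cauchy-Schwarz.

  If \<open>p = q = 1\<close>, the quotient of the two bounds is at most
  \<open>4 (1 + r)\<^sup>2 / ((1 + r)\<^sup>4 + (1 - r)\<^sup>4) = y\<^sup>2 (y + 1)\<^sup>2 / (y\<^sup>4 + 1)\<close> with \<open>y = (1 + r) / (1 - r)\<close>. The equation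
  \<open>x\<^sup>4 = 2 x + 1\<close> is the condition for a critical point of this function, and its value at \<open>y = x\<close>
  is \<open>c\<close>. The lemma \<open>scalar_ineq\<close> reduces unequal \<open>p\<close>, \<open>q\<close> to this case.

  Every step is an equality for two matrices \<open>A = e a\<^sup>*\<close>, \<open>B = e b\<^sup>*\<close> of rank one with the same range, where
  \<open>a\<close> and \<open>b\<close> have equal length and their angle is chosen such that \<open>P + Q\<close> has eigenvalue ratio \<open>x\<close>; see
  \<open>extremal_pair\<close>. This pair lives in dimension two and hence in every larger dimension.

  Moduli and Schatten norms are defined by functional calculus, so the spectral theorem
  \<open>hermitian_spectral\<close> is needed to see that \<open>|A|\<close> is a positive semidefinite square root of \<open>A\<^sup>*A\<close> and that
  the Schatten norm is given by the trace of \<open>(A\<^sup>*A)\<^sup>2\<close>.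
\<close>

section \<open>Adjoints and traces\<close>

lemma mat_adjoint_dim [simp]:
  "dim_row (mat_adjoint A) = dim_col A" "dim_col (mat_adjoint A) = dim_row A"
  by (simp_all add: mat_adjoint_def)

lemma mat_adjoint_index [simp]:
  fixes A :: "complex mat"
  assumes "i < dim_col A" "j < dim_row A"
  shows "mat_adjoint A $$ (i, j) = cnj (A $$ (j, i))"
  using assms by (simp add: mat_adjoint_def mat_of_rows_index)

lemma mat_adjoint_adjoint [simp]:
  fixes A :: "complex mat"
  shows "mat_adjoint (mat_adjoint A) = A"
  by (rule eq_matI) auto

lemma mat_mult_index:
  assumes "A \<in> carrier_mat n m" "B \<in> carrier_mat m k" "i < n" "j < k"
  shows "(A * B) $$ (i, j) = (\<Sum>l<m. A $$ (i, l) * B $$ (l, j))"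
  using assms by (auto simp: scalar_prod_def atLeast0LessThan)

lemma mat_adjoint_mult:
  fixes A B :: "complex mat"
  assumes "A \<in> carrier_mat n m" "B \<in> carrier_mat m k"
  shows "mat_adjoint (A * B) = mat_adjoint B * mat_adjoint A"
proof (rule eq_matI)
  fix i j
  assume "i < dim_row (mat_adjoint B * mat_adjoint A)" "j < dim_col (mat_adjoint B * mat_adjoint A)"
  then have ij: "i < k" "j < n" using assms by auto
  show "mat_adjoint (A * B) $$ (i, j) = (mat_adjoint B * mat_adjoint A) $$ (i, j)"
    using ij assms by (auto simp: scalar_prod_def mult.commute intro!: sum.cong)
qed (use assms in auto)

lemma mat_adjoint_add:
  fixes A B :: "complex mat"
  assumes "A \<in> carrier_mat n m" "B \<in> carrier_mat n m"
  shows "mat_adjoint (A + B) = mat_adjoint A + mat_adjoint B"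
  using assms by (intro eq_matI) auto

lemma mat_trace_add:
  fixes A B :: "complex mat"
  assumes "A \<in> carrier_mat n n" "B \<in> carrier_mat n n"
  shows "mat_trace (A + B) = mat_trace A + mat_trace B"
  using assms by (simp add: mat_trace_def sum.distrib)

lemma mat_trace_mult_commute:
  fixes A B :: "complex mat"
  assumes "A \<in> carrier_mat n m" "B \<in> carrier_mat m n"
  shows "mat_trace (A * B) = mat_trace (B * A)"
proof -
  have "mat_trace (A * B) = (\<Sum>i<n. \<Sum>l<m. A $$ (i, l) * B $$ (l, i))"
    using assms by (simp add: mat_trace_def mat_mult_index[OF assms] del: index_mult_mat(1))
  also have "\<dots> = (\<Sum>l<m. \<Sum>i<n. B $$ (l, i) * A $$ (i, l))"
    by (subst sum.swap) (simp add: mult.commute)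
  also have "\<dots> = mat_trace (B * A)"
    using assms by (simp add: mat_trace_def mat_mult_index[OF assms(2,1)] del: index_mult_mat(1))
  finally show ?thesis .
qed

section \<open>The real Frobenius inner product\<close>

text \<open>Taking the real part makes the Frobenius inner product symmetric and additive in both
  arguments, so that squares of sums expand as for real numbers.\<close>
definition frobenius :: "complex mat \<Rightarrow> complex mat \<Rightarrow> real" where
  "frobenius M N = Re (mat_trace (mat_adjoint M * N))"

lemma frobenius_eq_sum:
  assumes "M \<in> carrier_mat n n" "N \<in> carrier_mat n n"
  shows "frobenius M N = (\<Sum>(i, j)\<in>{..<n} \<times> {..<n}. Re (M $$ (i, j)) * Re (N $$ (i, j)) + Im (M $$ (i, j)) * Im (N $$ (i, j)))"
proof -
  have "frobenius M N = (\<Sum>j<n. \<Sum>i<n. Re (M $$ (i, j)) * Re (N $$ (i, j)) + Im (M $$ (i, j)) * Im (N $$ (i, j)))"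
    using assms by (auto simp: frobenius_def mat_trace_def scalar_prod_def atLeast0LessThan)
  then show ?thesis by (subst (asm) sum.swap) (simp add: sum.cartesian_product)
qed

lemma frobenius_commute:
  assumes "M \<in> carrier_mat n n" "N \<in> carrier_mat n n"
  shows "frobenius M N = frobenius N M"
  using assms by (simp add: frobenius_eq_sum mult.commute)

lemma frobenius_adjoint:
  assumes "M \<in> carrier_mat n n" "N \<in> carrier_mat n n"
  shows "frobenius (mat_adjoint M) (mat_adjoint N) = frobenius M N"
proof -
  have "frobenius (mat_adjoint M) (mat_adjoint N) = frobenius N M"
    using assms mat_trace_mult_commute[of M n n "mat_adjoint N"] by (simp add: frobenius_def)
  then show ?thesis using assms frobenius_commute by simp
qed

lemma frobenius_add_left:
  assumes "M \<in> carrier_mat n n" "N \<in> carrier_mat n n" "K \<in> carrier_mat n n"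
  shows "frobenius (M + N) K = frobenius M K + frobenius N K"
  using assms
  by (simp add: frobenius_def mat_adjoint_add[of M n n N] add_mult_distrib_mat[of _ n n] mat_trace_add[of _ n] mult_carrier_mat[of _ n n _ n])

lemma frobenius_add_right:
  assumes "M \<in> carrier_mat n n" "N \<in> carrier_mat n n" "K \<in> carrier_mat n n"
  shows "frobenius K (M + N) = frobenius K M + frobenius K N"
  using assms frobenius_add_left[of M n N K] frobenius_commute[of K n] by simp

lemma frobenius_self_nonneg:
  assumes "M \<in> carrier_mat n n"
  shows "0 \<le> frobenius M M"
  using assms unfolding frobenius_eq_sum[OF assms assms] by (intro sum_nonneg) auto

text \<open>The matrix is read as a real vector with two coordinates per entry, its real and its
  imaginary part.\<close>
lemma frobenius_Cauchy_Schwarz: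
  assumes "M \<in> carrier_mat n n" "N \<in> carrier_mat n n"
  shows "(frobenius M N)\<^sup>2 \<le> frobenius M M * frobenius N N"
proof -
  define I where "I = ({..<n} \<times> {..<n}) \<times> (UNIV :: bool set)"
  define f where "f M = (\<lambda>((i, j), b). if b then Re (M $$ (i, j)) else Im (M $$ (i, j)))" for M :: "complex mat"
  have eq: "frobenius A B = (\<Sum>k\<in>I. f A k * f B k)" if "A \<in> carrier_mat n n" "B \<in> carrier_mat n n" for A B
  proof -
    have "(\<Sum>k\<in>I. f A k * f B k) = (\<Sum>ij\<in>{..<n} \<times> {..<n}. \<Sum>b\<in>UNIV. f A (ij, b) * f B (ij, b))"
      by (simp add: I_def sum.cartesian_product)
    then show ?thesis
      unfolding frobenius_eq_sum[OF that] by (auto simp: f_def UNIV_bool intro!: sum.cong)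
  qed
  show ?thesis
  proof (rule abs_le_square_iff[THEN iffD1, THEN order_trans])
    have "\<bar>frobenius M N\<bar> \<le> (\<Sum>k\<in>I. \<bar>f M k\<bar> * \<bar>f N k\<bar>)"
      unfolding eq[OF assms] using sum_abs[of "\<lambda>k. f M k * f N k" I] by (simp add: abs_mult)
    also have "\<dots> \<le> L2_set (f M) I * L2_set (f N) I" by (rule L2_set_mult_ineq)
    finally show "\<bar>frobenius M N\<bar> \<le> \<bar>L2_set (f M) I * L2_set (f N) I\<bar>" by linarith
    show "(L2_set (f M) I * L2_set (f N) I)\<^sup>2 \<le> frobenius M M * frobenius N N"
      using assms by (simp add: eq L2_set_def power_mult_distrib sum_nonneg) (simp add: power2_eq_square)
  qed
qed

section \<open>Two estimates for fourth powers of sums\<close>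

lemma mat_sum_mult_sum:
  fixes K L M N :: "complex mat"
  assumes "K \<in> carrier_mat n n" "L \<in> carrier_mat n n" "M \<in> carrier_mat n n" "N \<in> carrier_mat n n"
  shows "(K + L) * (M + N) = (K * M + L * N) + (K * N + L * M)"
  using assms
  by (intro eq_matI)
     (auto simp: add_mult_distrib_mat[of _ n n _ _ n] mult_add_distrib_mat[of _ n n _ n] simp del: index_mult_mat(1))

lemma mat_adjoint_uminus:
  fixes A :: "complex mat"
  shows "mat_adjoint (- A) = - mat_adjoint A"
  by (intro eq_matI) auto

text \<open>By the parallelogram law \<open>X\<^sup>*X \<le> X\<^sup>*X + Y\<^sup>*Y = 2 (G + H)\<close> with \<open>Y = A - B\<close>. Replacing only one
  of the two factors in \<open>Tr (X\<^sup>*X X\<^sup>*X)\<close> by this majorant costs nothing for the extremal pair, while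
  replacing both would lose a constant factor. What remains is linear in the cross term
  \<open>A\<^sup>*B\<close>; after a cyclic rotation of the trace, Cauchy-Schwarz pairs \<open>B A\<^sup>*\<close> with \<open>A A\<^sup>*\<close> and with
  \<open>B B\<^sup>*\<close>, whose norms depend on \<open>G\<close> and \<open>H\<close> alone. This is how the phases of \<open>A\<close> and \<open>B\<close> disappear
  without a polar decomposition.\<close>
lemma gram_of_sum_norm_le:
  assumes A: "A \<in> carrier_mat n n" and B: "B \<in> carrier_mat n n"
  defines "G \<equiv> mat_adjoint A * A" and "H \<equiv> mat_adjoint B * B"
  defines "X \<equiv> A + B"
  shows "frobenius (mat_adjoint X * X) (mat_adjoint X * X)
    \<le> 2 * (frobenius G G + frobenius H H + 2 * frobenius G H) + 4 * sqrt (frobenius G H) * (sqrt (frobenius G G) + sqrt (frobenius H H))"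
proof -
  define Y where "Y = A + - B"
  note mc = mult_carrier_mat[of _ n n _ n] and as = assoc_mult_mat[of _ n n _ n _ n]
  have c [simp]: "A \<in> carrier_mat n n" "B \<in> carrier_mat n n" "G \<in> carrier_mat n n" "H \<in> carrier_mat n n"
     "X \<in> carrier_mat n n" "Y \<in> carrier_mat n n"
    using A B by (simp_all add: G_def H_def X_def Y_def mc)
  define S where "S = G + H"
  define C where "C = mat_adjoint A * B"
  have c2 [simp]: "S \<in> carrier_mat n n" "C \<in> carrier_mat n n" by (simp_all add: S_def C_def mc)
  have XX: "mat_adjoint X * X = S + (C + mat_adjoint C)"
    by (simp add: X_def S_def C_def G_def H_def mat_adjoint_add[of _ n n] mat_sum_mult_sum[of _ n]
        mat_adjoint_mult[of _ n n _ n])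
  have YY: "mat_adjoint Y * Y = S + - (C + mat_adjoint C)"
  proof -
    have "mat_adjoint Y * Y = (G + - mat_adjoint B * - B) + (mat_adjoint A * - B + - mat_adjoint B * A)"
      unfolding Y_def mat_adjoint_add[OF A uminus_carrier_mat[OF B]] mat_adjoint_uminus
      by (subst mat_sum_mult_sum[of _ n]) (auto simp: G_def)
    also have "- mat_adjoint B * - B = H" using A B by (auto simp: H_def)
    also have "mat_adjoint A * - B = - C" unfolding C_def by (intro uminus_mult_right_mat) (simp add: carrier_matD[OF A] carrier_matD[OF B])
    also have "- mat_adjoint B * A = - mat_adjoint C"
      by (simp add: C_def mat_adjoint_mult[of _ n n _ n])
         (intro uminus_mult_left_mat, simp add: carrier_matD[OF A] carrier_matD[OF B])
    finally show ?thesis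
      unfolding S_def by (simp add: uminus_add_mat[of _ n n] comm_add_mat[of "- C" n n])
  qed
  have par: "mat_adjoint X * X + mat_adjoint Y * Y = S + S"
    unfolding XX YY by (intro eq_matI) (auto dest: carrier_matD simp: carrier_matD[OF c2(1)] carrier_matD[OF c2(2)])
  \<comment> \<open>Each identity below compares traces of two words in the matrices and their adjoints that
    agree up to a cyclic rotation; the rotation is supplied explicitly.\<close>
  note words = frobenius_def mat_adjoint_mult[of _ n n _ n] as mc
  have Sadj: "mat_adjoint S = S"
    by (simp add: S_def G_def H_def mat_adjoint_add[of _ n n] mat_adjoint_mult[of _ n n _ n] mc)
  have "0 \<le> frobenius (X * mat_adjoint Y) (X * mat_adjoint Y)" by (intro frobenius_self_nonneg[of _ n]) (simp add: mc)
  also have "\<dots> = frobenius (mat_adjoint X * X) (mat_adjoint Y * Y)"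
    using mat_trace_mult_commute[of Y n n "mat_adjoint X * (X * mat_adjoint Y)"] by (simp add: words)
  finally have "frobenius (mat_adjoint X * X) (mat_adjoint X * X) \<le>
      frobenius (mat_adjoint X * X) (mat_adjoint X * X + mat_adjoint Y * Y)"
    by (simp add: frobenius_add_right[of _ n] mc)
  also have "\<dots> = 2 * frobenius (mat_adjoint X * X) S"
    by (simp add: par frobenius_add_right[of _ n] mc)
  also have "frobenius (mat_adjoint X * X) S = frobenius S S + (frobenius C S + frobenius (mat_adjoint C) S)"
    by (simp add: XX frobenius_add_left[of _ n])
  also have "frobenius (mat_adjoint C) S = frobenius C S"
    using frobenius_adjoint[of C n S] by (simp add: Sadj)
  also have "frobenius C S = frobenius C G + frobenius C H"
    by (simp add: S_def frobenius_add_right[of _ n])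
  also have "frobenius S S = frobenius G G + frobenius H H + 2 * frobenius G H"
    by (simp add: S_def frobenius_add_right[of _ n] frobenius_add_left[of _ n] frobenius_commute[of H n G])
  finally have main: "frobenius (mat_adjoint X * X) (mat_adjoint X * X)
      \<le> 2 * (frobenius G G + frobenius H H + 2 * frobenius G H) + 4 * (frobenius C G + frobenius C H)"
    by simp
  have R: "frobenius (B * mat_adjoint A) (B * mat_adjoint A) = frobenius G H"
    using frobenius_commute[of G n H] mat_trace_mult_commute[of A n n "mat_adjoint B * (B * mat_adjoint A)"]
    by (simp add: G_def H_def words)
  have "frobenius C G = frobenius (B * mat_adjoint A) (A * mat_adjoint A)"
    using mat_trace_mult_commute[of A n n "mat_adjoint B * (A * mat_adjoint A)"]
    by (simp add: C_def G_def words)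
  moreover have "frobenius (A * mat_adjoint A) (A * mat_adjoint A) = frobenius G G"
    using mat_trace_mult_commute[of A n n "mat_adjoint A * (A * mat_adjoint A)"]
    by (simp add: G_def words)
  ultimately have 1: "frobenius C G \<le> sqrt (frobenius G H) * sqrt (frobenius G G)"
    using frobenius_Cauchy_Schwarz[of "B * mat_adjoint A" n "A * mat_adjoint A"] R
    by (auto simp: mc real_sqrt_mult[symmetric] intro!: real_le_rsqrt)
  have "frobenius C H = frobenius (B * mat_adjoint A) (B * mat_adjoint B)"
    using mat_trace_mult_commute[of A n n "mat_adjoint B * (B * mat_adjoint B)"]
      mat_trace_mult_commute[of "mat_adjoint B * A" n n "mat_adjoint B * B"]
    by (simp add: C_def H_def words)
  moreover have "frobenius (B * mat_adjoint B) (B * mat_adjoint B) = frobenius H H"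
    using mat_trace_mult_commute[of B n n "mat_adjoint B * (B * mat_adjoint B)"]
    by (simp add: H_def words)
  ultimately have 2: "frobenius C H \<le> sqrt (frobenius G H) * sqrt (frobenius H H)"
    using frobenius_Cauchy_Schwarz[of "B * mat_adjoint A" n "B * mat_adjoint B"] R
    by (auto simp: mc real_sqrt_mult[symmetric] intro!: real_le_rsqrt)
  show ?thesis using main 1 2 by (simp add: algebra_simps)
qed

text \<open>Expanding the trace of \<open>(P + Q)\<^sup>4\<close> gives \<open>p + q + 4 r + 4 (\<alpha> + \<beta>) + 2 \<gamma>\<close> with
  \<open>\<alpha> = Tr P\<^sup>3Q\<close>, \<open>\<beta> = Tr PQ\<^sup>3\<close> and \<open>\<gamma> = Tr PQPQ\<close>. Positivity of \<open>P\<close> and \<open>Q\<close> enters through their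
  Hermitian roots \<open>G\<close> and \<open>F\<close>, which turn these traces into inner products. Cauchy-Schwarz then
  gives \<open>r\<^sup>2 \<le> \<alpha> \<beta>\<close>, hence \<open>\<alpha> + \<beta> \<ge> 2 r\<close>, and \<open>\<alpha>\<^sup>2 \<le> \<gamma> p\<close>, \<open>\<beta>\<^sup>2 \<le> \<gamma> q\<close>, hence
  \<open>r\<^sup>2 \<le> \<alpha> \<beta> \<le> \<gamma> sqrt (p q)\<close>. All of these are equalities when \<open>P\<close> and \<open>Q\<close> are projections onto
  lines, as they are, up to a common factor, for the extremal pair.\<close>
lemma fourth_power_of_sum_norm_ge:
  assumes G: "G \<in> carrier_mat n n" "mat_adjoint G = G" and F: "F \<in> carrier_mat n n" "mat_adjoint F = F"
  defines "P \<equiv> G * G" and "Q \<equiv> F * F"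
  defines "N \<equiv> P + Q"
  defines "p \<equiv> frobenius (P * P) (P * P)" and "q \<equiv> frobenius (Q * Q) (Q * Q)" and "r \<equiv> frobenius (P * P) (Q * Q)"
  obtains \<gamma> where "0 \<le> \<gamma>" "0 \<le> r" "r\<^sup>2 \<le> \<gamma> * sqrt p * sqrt q"
     "p + q + 12 * r + 2 * \<gamma> \<le> frobenius (N * N) (N * N)"
proof -
  note mc = mult_carrier_mat[of _ n n _ n] and as = assoc_mult_mat[of _ n n _ n _ n]
  have c [simp]: "G \<in> carrier_mat n n" "F \<in> carrier_mat n n" "P \<in> carrier_mat n n" "Q \<in> carrier_mat n n"
    using G F by (simp_all add: P_def Q_def mc)
  have adj [simp]: "mat_adjoint P = P" "mat_adjoint Q = Q" "mat_adjoint G = G" "mat_adjoint F = F"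
    using G F by (simp_all add: P_def Q_def mat_adjoint_mult[of _ n n _ n])
  define \<alpha> where "\<alpha> = frobenius (P * Q) (P * P)"
  define \<beta> where "\<beta> = frobenius (P * Q) (Q * Q)"
  define \<gamma> where "\<gamma> = frobenius (P * Q) (Q * P)"
  have QP: "Q * P = mat_adjoint (P * Q)"
    by (simp add: mat_adjoint_mult[of _ n n _ n])
  have NN: "N * N = (P * P + Q * Q) + (P * Q + Q * P)"
    unfolding N_def by (simp add: mat_sum_mult_sum[of _ n])
  have QPPP: "frobenius (Q * P) (P * P) = \<alpha>"
    using frobenius_adjoint[of "P * Q" n "P * P"] by (simp add: \<alpha>_def mat_adjoint_mult[of _ n n _ n] mc)
  have QPQQ: "frobenius (Q * P) (Q * Q) = \<beta>"
    using frobenius_adjoint[of "P * Q" n "Q * Q"] by (simp add: \<beta>_def mat_adjoint_mult[of _ n n _ n] mc)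
  have PQPQ: "frobenius (P * Q) (P * Q) = r"
    using mat_trace_mult_commute[of Q n n "P * (P * Q)"]
    by (simp add: r_def frobenius_def mat_adjoint_mult[of _ n n _ n] mc as)
  have QPQP: "frobenius (Q * P) (Q * P) = r"
    using frobenius_adjoint[of "P * Q" n "P * Q"] PQPQ by (simp add: mat_adjoint_mult[of _ n n _ n] mc)
  have expand: "frobenius (N * N) (N * N) = p + q + 4 * r + 4 * (\<alpha> + \<beta>) + 2 * \<gamma>"
    unfolding NN
    using QPPP QPQQ PQPQ QPQP frobenius_commute[of "P * P" n "P * Q"] frobenius_commute[of "Q * Q" n "P * Q"]
       frobenius_commute[of "P * P" n "Q * P"] frobenius_commute[of "Q * Q" n "Q * P"] frobenius_commute[of "Q * P" n "P * Q"]
       frobenius_commute[of "P * P" n "Q * Q"]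
    by (simp add: frobenius_add_left[of _ n] frobenius_add_right[of _ n] mc p_def q_def r_def \<alpha>_def \<beta>_def \<gamma>_def)
  \<comment> \<open>Written as words in \<open>G\<close> and \<open>F\<close>, the two sides of each identity are cyclic rotations of
    each other by one letter.\<close>
  note words = \<alpha>_def \<beta>_def \<gamma>_def p_def q_def r_def P_def Q_def frobenius_def mat_adjoint_mult[of _ n n _ n] as mc
  have \<alpha>: "\<alpha> = frobenius (G * P * F) (G * P * F)"
    using mat_trace_mult_commute[of F n n "F * (G * (G * (G * (G * (G * (G))))))"]
    by (simp add: words)
  have \<beta>: "\<beta> = frobenius (G * Q * F) (G * Q * F)"
    using mat_trace_mult_commute[of F n n "F * (F * (G * (G * (F * (F * (F))))))"]
    by (simp add: words)
  have r: "r = frobenius (G * P * F) (G * Q * F)"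
    using mat_trace_mult_commute[of F n n "G * (G * (G * (G * (F * (F * (F))))))"]
    by (simp add: words)
  have \<gamma>: "\<gamma> = frobenius (G * Q * G) (G * Q * G)"
    using mat_trace_mult_commute[of G n n "F * (F * (G * (G * (F * (F * (G))))))"]
    by (simp add: words)
  have \<gamma>': "\<gamma> = frobenius (F * P * F) (F * P * F)"
    using mat_trace_mult_commute[of F n n "F * (G * (G * (F * (F * (G * (G))))))"]
    by (simp add: words)
  have \<alpha>': "\<alpha> = frobenius (G * Q * G) (G * P * G)"
    using mat_trace_mult_commute[of G n n "F * (F * (G * (G * (G * (G * (G))))))"]
    by (simp add: words)
  have \<beta>': "\<beta> = frobenius (F * P * F) (F * Q * F)"
    using mat_trace_mult_commute[of F n n "F * (G * (G * (F * (F * (F * (F))))))"]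
    by (simp add: words)
  have p: "p = frobenius (G * P * G) (G * P * G)"
    by (simp add: words)
  have q: "q = frobenius (F * Q * F) (F * Q * F)"
    by (simp add: words)
  have \<alpha>\<beta>: "r\<^sup>2 \<le> \<alpha> * \<beta>"
    unfolding r \<alpha> \<beta> by (rule frobenius_Cauchy_Schwarz[of _ n]) (simp_all add: mc)
  have \<alpha>\<gamma>: "\<alpha>\<^sup>2 \<le> \<gamma> * p"
    unfolding \<alpha>' \<gamma> p by (rule frobenius_Cauchy_Schwarz[of _ n]) (simp_all add: mc)
  have \<beta>\<gamma>: "\<beta>\<^sup>2 \<le> \<gamma> * q"
    unfolding \<beta>' \<gamma>' q by (rule frobenius_Cauchy_Schwarz[of _ n]) (simp_all add: mc)
  have nonneg: "0 \<le> \<alpha>" "0 \<le> \<beta>" "0 \<le> \<gamma>" "0 \<le> r" "0 \<le> p" "0 \<le> q"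
    unfolding \<alpha> \<beta> \<gamma> p q PQPQ[symmetric] by (simp_all add: frobenius_self_nonneg[of _ n] mc)
  have "4 * r\<^sup>2 \<le> (\<alpha> + \<beta>)\<^sup>2"
    using \<alpha>\<beta> zero_le_power2[of "\<alpha> - \<beta>"] by (simp add: power2_sum power2_diff)
  then have "2 * r \<le> \<alpha> + \<beta>"
    by (intro power2_le_imp_le[of "2 * r" "\<alpha> + \<beta>"]) (use nonneg in \<open>auto simp: power_mult_distrib\<close>)
  moreover have "r\<^sup>2 \<le> \<gamma> * sqrt p * sqrt q"
  proof (rule power2_le_imp_le)
    have "(r\<^sup>2)\<^sup>2 \<le> (\<alpha> * \<beta>)\<^sup>2" using \<alpha>\<beta> by (intro power_mono) auto
    also have "\<dots> \<le> (\<gamma> * p) * (\<gamma> * q)"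
      unfolding power_mult_distrib using \<alpha>\<gamma> \<beta>\<gamma> nonneg by (intro mult_mono) auto
    also have "\<dots> = (\<gamma> * sqrt p * sqrt q)\<^sup>2"
      using nonneg by (simp add: power_mult_distrib) (simp add: power2_eq_square)
    finally show "(r\<^sup>2)\<^sup>2 \<le> (\<gamma> * sqrt p * sqrt q)\<^sup>2" .
  qed (use nonneg in auto)
  ultimately show thesis using that[of \<gamma>] nonneg expand by auto
qed

section \<open>The scalar inequality\<close>

text \<open>The scalar inequality below needs the constant to exceed 2 by a definite margin when \<open>p\<close> and
  \<open>q\<close> are far apart; this lower bound on \<open>x\<close> makes the constant at least 2.3.\<close>
lemma quartic_root_ge:
  fixes x :: real
  assumes "1 < x" "x ^ 4 = 2 * x + 1"
  shows "139 / 100 \<le> x"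
proof (rule ccontr)
  assume "\<not> 139 / 100 \<le> x"
  then have x: "x < 139 / 100" by simp
  have "x ^ 3 < (139 / 100) ^ 3" using assms x by (intro power_strict_mono) auto
  then have "x * (x ^ 3 - 2) \<le> x * (7 / 10)"
    using assms by (intro mult_left_mono) (auto simp: power3_eq_cube)
  moreover have "x * (x ^ 3 - 2) = 1"
    using assms(2) by (simp add: right_diff_distrib power4_eq_xxxx power3_eq_cube)
  ultimately show False using x by linarith
qed

text \<open>For \<open>v = 1\<close> the right-hand side minus the left-hand side is a quartic in \<open>u\<close> with a double
  zero at \<open>x\<close>: the constant is the maximum of \<open>u\<^sup>2 (u + 1)\<^sup>2 / (u\<^sup>4 + 1)\<close>, and the quartic equation for \<open>x\<close>
  says that the derivative vanishes there. Dividing by \<open>(u - x v)\<^sup>2\<close> leaves a quadratic form with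
  nonnegative coefficients.\<close>
lemma quartic_ineq:
  fixes x u v :: real
  assumes x: "1 < x" "x ^ 4 = 2 * x + 1" and "0 \<le> u" "0 \<le> v"
  shows "u\<^sup>2 * (u + v)\<^sup>2 \<le> x\<^sup>2 * (x + 1) / 2 * (u ^ 4 + v ^ 4)"
proof -
  define c where "c = x\<^sup>2 * (x + 1) / 2"
  have c1: "1 \<le> c"
    unfolding c_def using x mult_mono[of 1 "x\<^sup>2" 2 "x + 1"] by simp
  have "0 \<le> (u - x * v)\<^sup>2 * (x * (c - 1) * u\<^sup>2 + (x + 1) * (u * v) + x * (x + 1) / 2 * v\<^sup>2)"
    using assms c1 by (intro mult_nonneg_nonneg add_nonneg_nonneg) auto
  also have "\<dots> = x * (c * (u ^ 4 + v ^ 4) - u\<^sup>2 * (u + v)\<^sup>2)"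
  proof -
    have "(u - x * v)\<^sup>2 * (x * (c - 1) * u\<^sup>2 + (x + 1) * (u * v) + x * (x + 1) / 2 * v\<^sup>2)
        - x * (c * (u ^ 4 + v ^ 4) - u\<^sup>2 * (u + v)\<^sup>2)
      = (x ^ 4 - 2 * x - 1) * ((x + 1) * u\<^sup>2 * v * (x * v / 2 - u))"
      unfolding c_def by (simp add: field_simps power2_eq_square power4_eq_xxxx)
    then show ?thesis using x(2) by simp
  qed
  finally show ?thesis using x by (simp add: c_def zero_le_mult_iff)
qed

text \<open>With \<open>g = sqrt (p q)\<close> the case \<open>p = q = g\<close> is \<open>quartic_ineq\<close> at \<open>u = g + r\<close>, \<open>v = g - r\<close>.
  For general \<open>p\<close> and \<open>q\<close> with the same \<open>g\<close>, put \<open>s = p + q \<ge> 2 g\<close>: the gap between the two sides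
  is a convex quadratic in \<open>s\<close>. If \<open>r\<close> is small compared with \<open>g\<close>, it increases on \<open>s \<ge> 2 g\<close>, so
  the case \<open>s = 2 g\<close> decides. Otherwise its minimum over all \<open>s\<close> is already nonnegative, thanks to the
  term \<open>12 r\<^sup>2\<close>.\<close>
lemma scalar_ineq:
  fixes x p q r \<gamma> :: real
  assumes x: "1 < x" "x ^ 4 = 2 * x + 1"
    and nn: "0 \<le> p" "0 \<le> q" "0 \<le> r" "0 \<le> \<gamma>" "r\<^sup>2 \<le> p * q" "r ^ 4 \<le> \<gamma> * p * q"
  shows "2 * (p\<^sup>2 + q\<^sup>2 + 2 * r\<^sup>2) + 4 * r * (p + q) \<le> x\<^sup>2 * (x + 1) / 2 * (p\<^sup>2 + q\<^sup>2 + 12 * r\<^sup>2 + 2 * \<gamma>)"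
proof -
  define c where "c = x\<^sup>2 * (x + 1) / 2"
  have "(139 / 100)\<^sup>2 * (139 / 100 + 1) \<le> x\<^sup>2 * (x + 1)"
    using quartic_root_ge[OF x] by (intro mult_mono power_mono) auto
  then have c: "23 / 10 \<le> c" by (simp add: c_def power2_eq_square)
  define g where "g = sqrt (p * q)"
  define s where "s = p + q"
  have g2: "g\<^sup>2 = p * q" and g0: "0 \<le> g" using nn by (simp_all add: g_def)
  have rg: "r \<le> g" using nn by (simp add: g_def real_le_rsqrt)
  have pq: "p\<^sup>2 + q\<^sup>2 = s\<^sup>2 - 2 * g\<^sup>2" by (simp add: s_def g2 power2_sum)
  have "(2 * g)\<^sup>2 \<le> s\<^sup>2"
    using zero_le_power2[of "p - q"] unfolding power_mult_distrib g2 s_def by (simp add: power2_sum power2_diff)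
  then have sg: "2 * g \<le> s" using nn by (intro power2_le_imp_le[of "2*g" s]) (auto simp: s_def)
  show ?thesis
  proof (cases "g = 0")
    case True
    then have "r = 0" using rg nn by simp
    moreover have "2 * (p\<^sup>2 + q\<^sup>2) \<le> c * (p\<^sup>2 + q\<^sup>2 + 2 * \<gamma>)"
      using c nn by (intro mult_mono) auto
    ultimately show ?thesis unfolding c_def by simp
  next
    case False
    then have g: "0 < g" using g0 by simp
    have "4 * (g\<^sup>2 * (g + r)\<^sup>2) = (g + r)\<^sup>2 * ((g + r) + (g - r))\<^sup>2"
      by (simp add: power2_eq_square algebra_simps)
    also have "\<dots> \<le> c * ((g + r) ^ 4 + (g - r) ^ 4)"
      unfolding c_def using rg nn g by (intro quartic_ineq x) auto
    also have "(g + r) ^ 4 + (g - r) ^ 4 = 2 * g ^ 4 + 12 * r\<^sup>2 * g\<^sup>2 + 2 * r ^ 4"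
      by (simp add: power2_eq_square power4_eq_xxxx algebra_simps)
    also have "c * \<dots> \<le> c * (2 * g ^ 4 + 12 * r\<^sup>2 * g\<^sup>2 + 2 * (\<gamma> * g\<^sup>2))"
      using c nn by (intro mult_left_mono add_mono) (auto simp: g2)
    also have "\<dots> = g\<^sup>2 * (c * (2 * g\<^sup>2 + 12 * r\<^sup>2 + 2 * \<gamma>))"
      by (simp add: power2_eq_square power4_eq_xxxx algebra_simps)
    finally have "g\<^sup>2 * (4 * (g + r)\<^sup>2) \<le> g\<^sup>2 * (c * (2 * g\<^sup>2 + 12 * r\<^sup>2 + 2 * \<gamma>))"
      by (simp add: mult.left_commute)
    then have main: "4 * (g + r)\<^sup>2 \<le> c * (2 * g\<^sup>2 + 12 * r\<^sup>2 + 2 * \<gamma>)" using g by simp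
    show ?thesis
    proof (cases "r \<le> 3 / 10 * g")
      case True
      have "4 * r * (s - 2 * g) \<le> (c - 2) * (s + 2 * g) * (s - 2 * g)"
      proof (intro mult_right_mono)
        have "3 / 10 * (4 * g) \<le> (c - 2) * (s + 2 * g)"
          using c sg g by (intro mult_mono) auto
        then show "4 * r \<le> (c - 2) * (s + 2 * g)" using True by simp
      qed (use sg in simp)
      then have "4 * r * s - 8 * r * g \<le> (c - 2) * (s\<^sup>2 - 4 * g\<^sup>2)"
        by (simp add: power2_eq_square algebra_simps)
      then show ?thesis
        using main unfolding c_def[symmetric] s_def[symmetric] pq
        by (simp add: power2_sum algebra_simps)
    next
      case False
      \<comment> \<open>The minimiser \<open>2 r / (c - 2)\<close> of the quadratic, with \<open>c - 2\<close> bounded below by 3/10.\<close>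
      have "0 \<le> (s - 20 / 3 * r)\<^sup>2" by simp
      then have 1: "4 * r * s \<le> 3 / 10 * s\<^sup>2 + 40 / 3 * r\<^sup>2" by (simp add: power2_eq_square algebra_simps)
      have 2: "(3 / 10 * g)\<^sup>2 \<le> r\<^sup>2" using False g by (intro power_mono) auto
      have "9 * g\<^sup>2 \<le> 100 * r\<^sup>2" using 2 by (simp add: power_mult_distrib power_divide)
      then have "2 * (s\<^sup>2 - 2 * g\<^sup>2 + 2 * r\<^sup>2) + 4 * r * s \<le> 23 / 10 * (s\<^sup>2 - 2 * g\<^sup>2 + 12 * r\<^sup>2)"
        using 1 zero_le_power2[of r] unfolding distrib_left right_diff_distrib by linarith
      also have "\<dots> \<le> c * (s\<^sup>2 - 2 * g\<^sup>2 + 12 * r\<^sup>2 + 2 * \<gamma>)"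
        using c nn by (intro mult_mono) (auto simp flip: pq)
      finally show ?thesis unfolding c_def[symmetric] s_def[symmetric] pq .
    qed
  qed
qed

section \<open>The spectral theorem for Hermitian matrices\<close>

lemma unitary_mat_inverse:
  assumes "unitary_mat U" "U \<in> carrier_mat n n"
  shows "mat_adjoint U * U = 1\<^sub>m n" "U * mat_adjoint U = 1\<^sub>m n"
proof -
  show 1: "mat_adjoint U * U = 1\<^sub>m n" using assms by (auto simp: unitary_mat_def)
  show "U * mat_adjoint U = 1\<^sub>m n"
    by (rule mat_mult_left_right_inverse[OF _ _ 1]) (use assms in auto)
qed

lemma unitary_mat_mult:
  assumes "unitary_mat U" "U \<in> carrier_mat n n" "unitary_mat V" "V \<in> carrier_mat n n"
  shows "unitary_mat (U * V)"
proof -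
  have "mat_adjoint (U * V) * (U * V) = mat_adjoint V * ((mat_adjoint U * U) * V)"
    using assms by (simp add: mat_adjoint_mult[of _ n n _ n] assoc_mult_mat[of _ n n _ n _ n] mult_carrier_mat[of _ n n _ n])
  also have "\<dots> = 1\<^sub>m n"
    using assms by (simp add: unitary_mat_inverse[of U n] unitary_mat_inverse[of V n])
  finally show ?thesis using assms by (auto simp: unitary_mat_def)
qed

text \<open>Gram-Schmidt applied to a basis that starts with \<open>v\<close> gives orthogonal columns of nonzero
  length; dividing each by its length makes the matrix unitary.\<close>
lemma unitary_first_column:
  assumes v: "v \<in> carrier_vec n" "v \<noteq> 0\<^sub>v n" and n: "0 < n"
  obtains U k where "U \<in> carrier_mat n n" "unitary_mat U" "col U 0 = k \<cdot>\<^sub>v v"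
proof -
  interpret cof_vec_space n "TYPE(complex)" .
  define b where "b = basis_completion v"
  define ws where "ws = gram_schmidt n b"
  define W where "W = mat_of_cols n ws"
  have b: "set b \<subseteq> carrier_vec n" "distinct b" "\<not> lin_dep (set b)" "hd b = v" "length b = n"
    using basis_completion[OF v] by (auto simp: b_def)
  obtain vs where bv: "b = v # vs" using b(4,5) n by (cases b) auto
  have ws: "set ws \<subseteq> carrier_vec n" "corthogonal ws" "length ws = n"
    using gram_schmidt_result[OF b(1-3) refl] b(5) by (auto simp: ws_def)
  have hdws: "hd ws = v" using gram_schmidt_hd[OF v(1), of vs] by (simp add: ws_def bv)
  have W: "W \<in> carrier_mat n n" using ws mat_of_cols_carrier(1)[of n ws] by (simp add: W_def)
  have col: "col W j = ws ! j" if "j < n" for j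
    using that ws by (simp add: W_def subset_iff)
  define d where "d j = (\<Sum>l<n. (cmod (W $$ (l, j)))\<^sup>2)" for j
  have WW: "(\<Sum>l<n. cnj (W $$ (l, i)) * W $$ (l, j)) = (if i = j then complex_of_real (d j) else 0)"
    if "i < n" "j < n" for i j
  proof (cases "i = j")
    case True
    then show ?thesis
      by (simp add: d_def complex_norm_square mult.commute del: of_real_power)
  next
    case False
    then have "ws ! j \<bullet>c ws ! i = 0" using ws that unfolding corthogonal_def by simp
    then show ?thesis using that ws False W
      by (simp add: col[symmetric] scalar_prod_def atLeast0LessThan mult.commute)
  qed
  have dpos: "0 < d j" if "j < n" for j
  proof -
    have "ws ! j \<bullet>c ws ! j \<noteq> 0" using ws that unfolding corthogonal_def by simp
    then have "complex_of_real (d j) \<noteq> 0"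
      using WW[OF that that] that W by (simp add: col[symmetric] scalar_prod_def atLeast0LessThan mult.commute)
    moreover have "0 \<le> d j" by (auto simp: d_def intro: sum_nonneg)
    ultimately show ?thesis by auto
  qed
  define U where "U = mat n n (\<lambda>(i, j). W $$ (i, j) / complex_of_real (sqrt (d j)))"
  have U: "U \<in> carrier_mat n n" by (simp add: U_def)
  have "mat_adjoint U * U = 1\<^sub>m n"
  proof (rule eq_matI)
    fix i j assume "i < dim_row (1\<^sub>m n)" "j < dim_col (1\<^sub>m n)"
    then have ij: "i < n" "j < n" by auto
    have "(mat_adjoint U * U) $$ (i, j)
        = (\<Sum>l<n. cnj (W $$ (l, i)) * W $$ (l, j)) / complex_of_real (sqrt (d i) * sqrt (d j))"
      using ij U by (simp add: mat_mult_index[of _ n n _ n] U_def sum_divide_distrib del: index_mult_mat(1))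
    also have "\<dots> = (1\<^sub>m n :: complex mat) $$ (i, j)"
      unfolding WW[OF ij] using ij dpos[of j] by (simp add: of_real_mult[symmetric] del: of_real_mult)
    finally show "(mat_adjoint U * U) $$ (i, j) = (1\<^sub>m n :: complex mat) $$ (i, j)" .
  qed (use U in auto)
  then have "unitary_mat U" using U by (auto simp: unitary_mat_def)
  moreover have "col U 0 = (1 / complex_of_real (sqrt (d 0))) \<cdot>\<^sub>v v"
  proof -
    have "v = col W 0" using col[of 0] n hdws ws(3) hd_conv_nth[of ws] by (cases ws) auto
    then show ?thesis using n W by (intro eq_vecI) (auto simp: U_def)
  qed
  ultimately show thesis using that U by blast
qed

lemma unitary_conj_carrier:
  assumes "U \<in> carrier_mat n n"
  shows "unitary_conj U d \<in> carrier_mat n n"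
  using assms by (auto simp: unitary_conj_def mat_diag_def)

lemma unitary_conj_index:
  assumes "U \<in> carrier_mat n n" "i < n" "j < n"
  shows "unitary_conj U d $$ (i, j) = (\<Sum>l<n. U $$ (i, l) * complex_of_real (d l) * cnj (U $$ (j, l)))"
  using assms
  by (simp add: unitary_conj_def mat_diag_mult_right[of _ n] mat_mult_index[of _ n n _ n] del: index_mult_mat(1))

lemma unitary_conj_unitary_conj:
  assumes "U \<in> carrier_mat n n" "V \<in> carrier_mat n n"
  shows "U * unitary_conj V d * mat_adjoint U = unitary_conj (U * V) d"
  using assms
  by (simp add: unitary_conj_def mat_adjoint_mult[of _ n n _ n] assoc_mult_mat[of _ n n _ n _ n] mult_carrier_mat[of _ n n _ n])

text \<open>Deflation. A unitary whose first column is an eigenvector conjugates \<open>H\<close> to a matrix \<open>M\<close> whose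
  first column is a multiple of the first unit vector. As \<open>M\<close> is Hermitian, its first row has the same
  form and its corner is real, so the induction hypothesis applies to the remaining block \<open>K\<close>.\<close>
theorem hermitian_spectral:
  assumes "H \<in> carrier_mat n n" "mat_adjoint H = H"
  shows "\<exists>U d. U \<in> carrier_mat n n \<and> unitary_mat U \<and> H = unitary_conj U d"
  using assms
proof (induction n arbitrary: H)
  case 0
  then show ?case
    by (intro exI[of _ "1\<^sub>m 0"] exI[of _ "\<lambda>_. 0"]) (auto simp: unitary_mat_def unitary_conj_def)
next
  case (Suc n)
  note H = Suc.prems
  let ?m = "Suc n"
  note mc = mult_carrier_mat[of _ ?m ?m _ ?m] and as = assoc_mult_mat[of _ ?m ?m _ ?m _ ?m]
  obtain e v where ev: "eigenvector H v e"
    using spectrum_non_empty[OF H(1)] by (auto simp: spectrum_def eigenvalue_def)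
  then have v: "v \<in> carrier_vec ?m" "v \<noteq> 0\<^sub>v ?m" and Hv: "H *\<^sub>v v = e \<cdot>\<^sub>v v"
    using H by (auto simp: eigenvector_def)
  obtain U k where U: "U \<in> carrier_mat ?m ?m" "unitary_mat U" and colU: "col U 0 = k \<cdot>\<^sub>v v"
    using unitary_first_column[OF v] by auto
  note UU = unitary_mat_inverse[OF U(2,1)]
  define M where "M = mat_adjoint U * (H * U)"
  have M: "M \<in> carrier_mat ?m ?m" using U H by (simp add: M_def mc)
  have Madj: "mat_adjoint M = M"
    using U H by (simp add: M_def mat_adjoint_mult[of _ ?m ?m _ ?m] mc as)
  have HM: "H = U * M * mat_adjoint U"
  proof -
    have "U * M * mat_adjoint U = (U * mat_adjoint U) * (H * (U * mat_adjoint U))"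
      using U H by (simp add: M_def mc as)
    then show ?thesis using UU H by simp
  qed
  have col0: "M $$ (i, 0) = (if i = 0 then e else 0)" if "i < ?m" for i
  proof -
    have HU0: "(H * U) $$ (l, 0) = e * U $$ (l, 0)" if "l < ?m" for l
    proof -
      have "(H * U) $$ (l, 0) = (H *\<^sub>v col U 0) $ l" using that H U by simp
      also have "H *\<^sub>v col U 0 = e \<cdot>\<^sub>v col U 0"
        unfolding colU using mult_mat_vec[OF H(1) v(1)] Hv v by (simp add: smult_smult_assoc mult.commute)
      also have "\<dots> $ l = e * U $$ (l, 0)" using that U by simp
      finally show ?thesis .
    qed
    have "M $$ (i, 0) = (\<Sum>l<?m. mat_adjoint U $$ (i, l) * (H * U) $$ (l, 0))"
      unfolding M_def by (rule mat_mult_index[of _ ?m ?m _ ?m]) (use that U H in \<open>auto simp: mc\<close>)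
    also have "\<dots> = (\<Sum>l<?m. e * (mat_adjoint U $$ (i, l) * U $$ (l, 0)))"
      by (intro sum.cong refl) (simp add: HU0)
    also have "\<dots> = e * (mat_adjoint U * U) $$ (i, 0)"
      using that U by (simp add: mat_mult_index[of _ ?m ?m _ ?m] sum_distrib_left del: index_mult_mat(1) sum.lessThan_Suc)
    also have "\<dots> = (if i = 0 then e else 0)" using that by (simp add: UU)
    finally show ?thesis .
  qed
  have Msym: "M $$ (i, j) = cnj (M $$ (j, i))" if "i < ?m" "j < ?m" for i j
    using that M arg_cong[OF Madj, of "\<lambda>X. X $$ (i, j)"] by simp
  have row0: "M $$ (0, i) = (if i = 0 then e else 0)" if "i < ?m" for i
    using Msym[of 0 i] Msym[of 0 0] col0[of 0] col0[OF that] that by auto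
  have e: "e = complex_of_real (Re e)"
    using Msym[of 0 0] col0[of 0] by (simp add: complex_eq_iff)
  define K where "K = mat n n (\<lambda>(i, j). M $$ (Suc i, Suc j))"
  have "mat_adjoint K = K"
    by (intro eq_matI) (auto simp: K_def intro!: Msym[symmetric])
  then obtain V d where V: "V \<in> carrier_mat n n" "unitary_mat V" and KV: "K = unitary_conj V d"
    using Suc.IH[of K] by (auto simp: K_def)
  define V' where "V' = mat ?m ?m (\<lambda>(i, j). case (i, j) of
    (0, 0) \<Rightarrow> 1 | (Suc i, Suc j) \<Rightarrow> V $$ (i, j) | _ \<Rightarrow> (0 :: complex))"
  define d' where "d' = case_nat (Re e) d"
  have V': "V' \<in> carrier_mat ?m ?m" by (simp add: V'_def)
  have "mat_adjoint V' * V' = 1\<^sub>m ?m"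
  proof (rule eq_matI)
    fix i j assume "i < dim_row (1\<^sub>m ?m)" "j < dim_col (1\<^sub>m ?m)"
    then have ij: "i < ?m" "j < ?m" by auto
    have VV: "(\<Sum>l<n. cnj (V $$ (l, a)) * V $$ (l, b)) = (if a = b then 1 else 0)" if "a < n" "b < n" for a b
      using that V arg_cong[OF unitary_mat_inverse(1)[OF V(2,1)], of "\<lambda>X. X $$ (a, b)"]
      by (simp add: mat_mult_index[of _ n n _ n] del: index_mult_mat(1))
    have "(mat_adjoint V' * V') $$ (i, j) = (\<Sum>l<?m. cnj (V' $$ (l, i)) * V' $$ (l, j))"
      using ij V' by (simp add: mat_mult_index[of _ ?m ?m _ ?m] del: index_mult_mat(1) sum.lessThan_Suc)
    also have "\<dots> = (1\<^sub>m ?m :: complex mat) $$ (i, j)"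
      using ij unfolding sum.lessThan_Suc_shift
      by (cases i; cases j) (simp_all add: V'_def VV)
    finally show "(mat_adjoint V' * V') $$ (i, j) = (1\<^sub>m ?m :: complex mat) $$ (i, j)" .
  qed (use V' in auto)
  then have uV': "unitary_mat V'" using V' by (auto simp: unitary_mat_def)
  have "M = unitary_conj V' d'"
  proof (rule eq_matI)
    fix i j assume "i < dim_row (unitary_conj V' d')" "j < dim_col (unitary_conj V' d')"
    then have ij: "i < ?m" "j < ?m" using unitary_conj_carrier[OF V', of d'] by auto
    have KK: "M $$ (Suc a, Suc b) = (\<Sum>l<n. V $$ (a, l) * complex_of_real (d l) * cnj (V $$ (b, l)))"
      if "a < n" "b < n" for a b
      using that arg_cong[OF KV, of "\<lambda>X. X $$ (a, b)"] V by (simp add: unitary_conj_index K_def)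
    show "M $$ (i, j) = unitary_conj V' d' $$ (i, j)"
      unfolding unitary_conj_index[OF V' ij] sum.lessThan_Suc_shift
      using ij e by (cases i; cases j) (simp_all add: V'_def d'_def KK row0 col0)
  qed (use M unitary_conj_carrier[OF V', of d'] in auto)
  then have "H = unitary_conj (U * V') d'"
    using HM unitary_conj_unitary_conj[OF U(1) V'] by simp
  moreover have "unitary_mat (U * V')" by (rule unitary_mat_mult[OF U(2,1) uV' V'])
  moreover have "U * V' \<in> carrier_mat ?m ?m" using U V' by simp
  ultimately show ?case by blast
qed

section \<open>Moduli and the Schatten 4-norm\<close>

lemma mat_diag_adjoint:
  "mat_adjoint (mat_diag n (\<lambda>i. complex_of_real (d i))) = mat_diag n (\<lambda>i. complex_of_real (d i))"
  by (intro eq_matI) (auto simp: mat_diag_def)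

lemma unitary_conj_adjoint:
  assumes "U \<in> carrier_mat n n"
  shows "mat_adjoint (unitary_conj U d) = unitary_conj U d"
  using assms
  by (simp add: unitary_conj_def mat_adjoint_mult[of _ n n _ n] assoc_mult_mat[of _ n n _ n _ n]
      mult_carrier_mat[of _ n n _ n] mat_diag_adjoint)

lemma unitary_conj_mult:
  assumes "U \<in> carrier_mat n n" "unitary_mat U"
  shows "unitary_conj U d * unitary_conj U e = unitary_conj U (\<lambda>i. d i * e i)"
proof -
  let ?D = "\<lambda>d. mat_diag n (\<lambda>i. complex_of_real (d i))"
  note c = assms(1) mult_carrier_mat[of _ n n _ n] assoc_mult_mat[of _ n n _ n _ n]
  have dim: "dim_row U = n" using assms by simp
  have "unitary_conj U d * unitary_conj U e = U * (?D d * ((mat_adjoint U * U) * (?D e * mat_adjoint U)))"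
    using assms(1) by (simp add: unitary_conj_def c dim)
  also have "\<dots> = U * ((?D d * ?D e) * mat_adjoint U)"
    by (subst unitary_mat_inverse[OF assms(2,1)]) (simp add: c left_mult_one_mat[of _ n n] del: mat_diag_diag)
  also have "?D d * ?D e = ?D (\<lambda>i. d i * e i)" by simp
  finally show ?thesis by (simp add: unitary_conj_def c dim)
qed

lemma unitary_conj_cong:
  assumes "U \<in> carrier_mat n n" "\<And>i. i < n \<Longrightarrow> d i = e i"
  shows "unitary_conj U d = unitary_conj U e"
proof -
  have "mat_diag n (\<lambda>i. complex_of_real (d i)) = mat_diag n (\<lambda>i. complex_of_real (e i))"
    using assms(2) by (intro eq_matI) (auto simp: mat_diag_def)
  then show ?thesis using assms(1) by (simp add: unitary_conj_def)
qed

text \<open>The diagonal entries of \<open>(GU)\<^sup>*(GU) = U\<^sup>*(G\<^sup>*G)U\<close> are sums of squared moduli. Only the first \<open>n\<close> values of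
  \<open>d\<close> matter, so the others may be chosen nonnegative as well.\<close>
lemma gram_spectral:
  assumes G: "G \<in> carrier_mat n n"
  obtains U d where "U \<in> carrier_mat n n" "unitary_mat U" "mat_adjoint G * G = unitary_conj U d" "\<And>i. 0 \<le> d i"
proof -
  have "mat_adjoint (mat_adjoint G * G) = mat_adjoint G * G"
    using G by (simp add: mat_adjoint_mult[of _ n n _ n])
  then obtain U d where U: "U \<in> carrier_mat n n" "unitary_mat U" and eq: "mat_adjoint G * G = unitary_conj U d"
    using hermitian_spectral[of "mat_adjoint G * G" n] G by (auto simp: mult_carrier_mat[of _ n n _ n])
  note mc = mult_carrier_mat[of _ n n _ n] and as = assoc_mult_mat[of _ n n _ n _ n]
  have nonneg: "0 \<le> d i" if i: "i < n" for i
  proof -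
    let ?D = "mat_diag n (\<lambda>i. complex_of_real (d i))"
    have "mat_adjoint (G * U) * (G * U) = mat_adjoint U * (mat_adjoint G * G) * U"
      using G U by (simp add: mat_adjoint_mult[of _ n n _ n] mc as)
    also have "\<dots> = (mat_adjoint U * U) * ?D * (mat_adjoint U * U)"
      unfolding eq using U carrier_matD[OF U(1)] by (simp add: unitary_conj_def mc as)
    also have "\<dots> = ?D"
      by (simp add: unitary_mat_inverse[OF U(2,1)] left_mult_one_mat[of _ n n] right_mult_one_mat[of _ n n])
    finally have "(mat_adjoint (G * U) * (G * U)) $$ (i, i) = complex_of_real (d i)"
      using i by (simp add: mat_diag_def)
    moreover have "0 \<le> Re ((mat_adjoint (G * U) * (G * U)) $$ (i, i))"
      using i G U by (subst mat_mult_index[of _ n n _ n]) (auto simp: mc simp del: index_mult_mat(1) intro!: add_nonneg_nonneg sum_nonneg)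
    ultimately show ?thesis by simp
  qed
  have "unitary_conj U d = unitary_conj U (\<lambda>i. max 0 (d i))"
    using nonneg by (intro unitary_conj_cong[OF U(1)]) simp
  then show thesis using that[of U "\<lambda>i. max 0 (d i)"] U eq by simp
qed

lemma mat_abs_spectral:
  assumes A: "A \<in> carrier_mat n n"
  obtains U d where "U \<in> carrier_mat n n" "unitary_mat U" "\<And>i. 0 \<le> d i"
    "mat_abs A = unitary_conj U d" "mat_adjoint A * A = unitary_conj U (\<lambda>i. d i * d i)"
proof -
  obtain U d where U: "U \<in> carrier_mat n n" "unitary_mat U" and eq: "mat_adjoint A * A = unitary_conj U d"
    and d: "\<And>i. 0 \<le> d i" using gram_spectral[OF A] by blast
  have "mat_abs A = unitary_conj U (\<lambda>i. sqrt (d i))"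
    using U d by (simp add: mat_abs_def mat_powr_def eq herm_fun_unitary_conj o_def powr_half_sqrt)
  then show thesis using that[of U "\<lambda>i. sqrt (d i)"] U eq d by simp
qed

text \<open>The Hermitian square root of the modulus is what the lower estimate for fourth powers of sums
  takes as input.\<close>
lemma mat_abs_square_root:
  assumes A: "A \<in> carrier_mat n n"
  obtains G where "G \<in> carrier_mat n n" "mat_adjoint G = G" "mat_abs A = G * G"
    "mat_abs A * mat_abs A = mat_adjoint A * A"
proof -
  obtain U d where U: "U \<in> carrier_mat n n" "unitary_mat U" "\<And>i. 0 \<le> d i"
    "mat_abs A = unitary_conj U d" "mat_adjoint A * A = unitary_conj U (\<lambda>i. d i * d i)"
    using mat_abs_spectral[OF A] by blast
  show thesis
    by (rule that[of "unitary_conj U (\<lambda>i. sqrt (d i))"])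
       (use U in \<open>simp_all add: unitary_conj_carrier unitary_conj_adjoint unitary_conj_mult\<close>)
qed

text \<open>A positive semidefinite square root of \<open>A\<^sup>*A\<close> is the modulus of \<open>A\<close>. Positivity is expressed by
  a Gram matrix, which is easy to exhibit for concrete matrices.\<close>
lemma mat_abs_eqI:
  assumes A: "A \<in> carrier_mat n n" and G: "G \<in> carrier_mat n n"
    and eq: "mat_adjoint A * A = (mat_adjoint G * G) * (mat_adjoint G * G)"
  shows "mat_abs A = mat_adjoint G * G"
proof -
  obtain U d where U: "U \<in> carrier_mat n n" "unitary_mat U" and GG: "mat_adjoint G * G = unitary_conj U d"
    and d: "\<And>i. 0 \<le> d i" using gram_spectral[OF G] by blast
  have "mat_abs A = unitary_conj U ((\<lambda>t. t powr (1 / 2)) \<circ> (\<lambda>i. d i * d i))"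
    unfolding mat_abs_def mat_powr_def eq GG unitary_conj_mult[OF U]
    by (rule herm_fun_unitary_conj[OF U(2)])
  also have "(\<lambda>t. t powr (1 / 2)) \<circ> (\<lambda>i. d i * d i) = d"
    using d by (simp add: fun_eq_iff powr_half_sqrt)
  finally show ?thesis by (simp add: GG)
qed

lemma quarter_powr_power_4:
  fixes a :: real
  assumes "0 \<le> a"
  shows "(a powr (1 / 4)) ^ 4 = a"
proof (cases "a = 0")
  case False
  then show ?thesis using assms powr_realpow[of "a powr (1 / 4)" 4] by (simp add: powr_powr)
qed simp

lemma schatten_norm_4:
  assumes A: "A \<in> carrier_mat n n"
  shows "schatten_norm 4 A ^ 4 = frobenius (mat_adjoint A * A) (mat_adjoint A * A)"
proof -
  obtain U d where U: "U \<in> carrier_mat n n" "unitary_mat U" and d: "\<And>i. 0 \<le> d i"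
    and eq: "mat_abs A = unitary_conj U d" "mat_adjoint A * A = unitary_conj U (\<lambda>i. d i * d i)"
    using mat_abs_spectral[OF A] by blast
  have "mat_powr (mat_abs A) 4 = unitary_conj U ((\<lambda>t. t powr 4) \<circ> d)"
    unfolding mat_powr_def eq by (rule herm_fun_unitary_conj[OF U(2)])
  also have "(\<lambda>t. t powr 4) \<circ> d = (\<lambda>i. (d i * d i) * (d i * d i))"
    using d by (simp add: fun_eq_iff powr_numeral power4_eq_xxxx mult.assoc)
  also have "unitary_conj U \<dots> = mat_adjoint (mat_adjoint A * A) * (mat_adjoint A * A)"
    unfolding eq using U by (simp add: unitary_conj_adjoint unitary_conj_mult)
  finally have tr: "Re (mat_trace (mat_powr (mat_abs A) 4)) = frobenius (mat_adjoint A * A) (mat_adjoint A * A)"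
    by (simp add: frobenius_def)
  have "0 \<le> frobenius (mat_adjoint A * A) (mat_adjoint A * A)"
    using A by (intro frobenius_self_nonneg[of _ n]) (simp add: mult_carrier_mat[of _ n n _ n])
  then show ?thesis
    unfolding schatten_norm_def tr by (rule quarter_powr_power_4)
qed

section \<open>The sharp inequality\<close>

lemma schatten_4_bound:
  fixes x :: real
  assumes x: "1 < x" "x ^ 4 = 2 * x + 1"
    and A: "A \<in> carrier_mat n n" and B: "B \<in> carrier_mat n n"
  shows "schatten_norm 4 (A + B) ^ 4 \<le> x\<^sup>2 * (x + 1) / 2 * schatten_norm 4 (mat_abs A + mat_abs B) ^ 4"
proof -
  obtain G where G: "G \<in> carrier_mat n n" "mat_adjoint G = G" "mat_abs A = G * G"
      "mat_abs A * mat_abs A = mat_adjoint A * A"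
    using mat_abs_square_root[OF A] by blast
  obtain F where F: "F \<in> carrier_mat n n" "mat_adjoint F = F" "mat_abs B = F * F"
      "mat_abs B * mat_abs B = mat_adjoint B * B"
    using mat_abs_square_root[OF B] by blast
  define N where "N = mat_abs A + mat_abs B"
  have N: "N \<in> carrier_mat n n" using G F by (simp add: N_def mult_carrier_mat[of _ n n _ n])
  have Nadj: "mat_adjoint N = N"
    using G(1,2) F(1,2) unfolding N_def G(3) F(3)
    by (simp add: mat_adjoint_add[of _ n n] mat_adjoint_mult[of _ n n _ n] mult_carrier_mat[of _ n n _ n])
  define P2 where "P2 = mat_adjoint A * A"
  define Q2 where "Q2 = mat_adjoint B * B"
  have c: "P2 \<in> carrier_mat n n" "Q2 \<in> carrier_mat n n"
    using A B by (simp_all add: P2_def Q2_def mult_carrier_mat[of _ n n _ n])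
  define p where "p = sqrt (frobenius P2 P2)"
  define q where "q = sqrt (frobenius Q2 Q2)"
  define r where "r = sqrt (frobenius P2 Q2)"
  obtain \<gamma> where \<gamma>: "0 \<le> \<gamma>" "0 \<le> frobenius P2 Q2" "(frobenius P2 Q2)\<^sup>2 \<le> \<gamma> * p * q"
     "frobenius P2 P2 + frobenius Q2 Q2 + 12 * frobenius P2 Q2 + 2 * \<gamma> \<le> frobenius (N * N) (N * N)"
    using fourth_power_of_sum_norm_ge[OF G(1,2) F(1,2)] unfolding G(3)[symmetric] F(3)[symmetric] G(4) F(4)
      N_def[symmetric] P2_def[symmetric] Q2_def[symmetric] p_def[symmetric] q_def[symmetric] by blast
  have sq: "frobenius P2 P2 = p\<^sup>2" "frobenius Q2 Q2 = q\<^sup>2" "frobenius P2 Q2 = r\<^sup>2"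
    using frobenius_self_nonneg[OF c(1)] frobenius_self_nonneg[OF c(2)] \<gamma>(2) by (simp_all add: p_def q_def r_def)
  have nn: "0 \<le> p" "0 \<le> q" "0 \<le> r"
    using sq frobenius_self_nonneg[OF c(1)] frobenius_self_nonneg[OF c(2)] \<gamma>(2) by (simp_all add: p_def q_def r_def)
  have "(r\<^sup>2)\<^sup>2 \<le> (p * q)\<^sup>2"
    using frobenius_Cauchy_Schwarz[OF c] by (simp add: sq power_mult_distrib)
  then have rpq: "r\<^sup>2 \<le> p * q"
    by (rule power2_le_imp_le) (intro mult_nonneg_nonneg nn)
  have "schatten_norm 4 (A + B) ^ 4 \<le> 2 * (p\<^sup>2 + q\<^sup>2 + 2 * r\<^sup>2) + 4 * r * (p + q)"
    using gram_of_sum_norm_le[OF A B] schatten_norm_4[of "A + B" n] A B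
    unfolding P2_def[symmetric] Q2_def[symmetric] p_def[symmetric] q_def[symmetric] r_def[symmetric] sq
    using nn by simp
  also have "\<dots> \<le> x\<^sup>2 * (x + 1) / 2 * (p\<^sup>2 + q\<^sup>2 + 12 * r\<^sup>2 + 2 * \<gamma>)"
  proof (rule scalar_ineq[OF x nn \<gamma>(1) rpq])
    show "r ^ 4 \<le> \<gamma> * p * q" using \<gamma>(3) unfolding sq by simp
  qed
  also have "\<dots> \<le> x\<^sup>2 * (x + 1) / 2 * frobenius (N * N) (N * N)"
    using \<gamma>(4) unfolding sq by (rule mult_left_mono) (use x(1) in simp)
  also have "frobenius (N * N) (N * N) = schatten_norm 4 N ^ 4"
    using schatten_norm_4[OF N] by (simp add: Nadj)
  finally show ?thesis by (simp add: N_def)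
qed

section \<open>The extremal pair\<close>

text \<open>Padding a two-by-two matrix by zeros realises the extremal pair in every dimension at least two.\<close>
definition corner_mat :: "nat \<Rightarrow> complex \<Rightarrow> complex \<Rightarrow> complex \<Rightarrow> complex \<Rightarrow> complex mat" where
  "corner_mat n a b c d = mat n n (\<lambda>(i, j).
     if i = 0 \<and> j = 0 then a else if i = 0 \<and> j = 1 then b
     else if i = 1 \<and> j = 0 then c else if i = 1 \<and> j = 1 then d else 0)"

lemma corner_mat_carrier [simp]: "corner_mat n a b c d \<in> carrier_mat n n"
  by (simp add: corner_mat_def)

lemma corner_mat_add:
  "corner_mat n a b c d + corner_mat n a' b' c' d' = corner_mat n (a + a') (b + b') (c + c') (d + d')"
  by (intro eq_matI) (auto simp: corner_mat_def)

lemma corner_mat_adjoint: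
  "mat_adjoint (corner_mat n a b c d) = corner_mat n (cnj a) (cnj c) (cnj b) (cnj d)"
  by (intro eq_matI) (auto simp: corner_mat_def)

lemma corner_mat_mult:
  assumes "2 \<le> n"
  shows "corner_mat n a b c d * corner_mat n a' b' c' d'
    = corner_mat n (a * a' + b * c') (a * b' + b * d') (c * a' + d * c') (c * b' + d * d')"
proof (rule eq_matI)
  fix i j
  assume "i < dim_row (corner_mat n (a * a' + b * c') (a * b' + b * d') (c * a' + d * c') (c * b' + d * d'))"
    "j < dim_col (corner_mat n (a * a' + b * c') (a * b' + b * d') (c * a' + d * c') (c * b' + d * d'))"
  then have ij: "i < n" "j < n" by (simp_all add: corner_mat_def)
  obtain m where m: "n = Suc (Suc m)" using assms by (metis add_2_eq_Suc le_Suc_ex)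
  show "(corner_mat n a b c d * corner_mat n a' b' c' d') $$ (i, j)
      = corner_mat n (a * a' + b * c') (a * b' + b * d') (c * a' + d * c') (c * b' + d * d') $$ (i, j)"
    unfolding mat_mult_index[OF corner_mat_carrier corner_mat_carrier ij] using ij
    unfolding m sum.lessThan_Suc_shift by (auto simp: corner_mat_def)
qed (simp_all add: corner_mat_def)

lemma corner_mat_frobenius:
  assumes "2 \<le> n"
  shows "frobenius (corner_mat n a 0 0 d) (corner_mat n a 0 0 d) = (cmod a)\<^sup>2 + (cmod d)\<^sup>2"
proof -
  obtain m where m: "n = Suc (Suc m)" using assms by (metis add_2_eq_Suc le_Suc_ex)
  have "mat_trace (corner_mat n a' b' c' d') = a' + d'" for a' b' c' d'
    unfolding mat_trace_def carrier_matD[OF corner_mat_carrier] unfolding m sum.lessThan_Suc_shift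
    by (simp add: corner_mat_def)
  then show ?thesis
    using assms unfolding frobenius_def corner_mat_adjoint by (simp add: corner_mat_mult cmod_power2) (simp add: power2_eq_square)
qed

text \<open>With \<open>a = (sqrt x, 1)\<close> and \<open>b = (sqrt x, -1)\<close>, the matrices \<open>A\<close> and \<open>B\<close> are \<open>sqrt (x + 1)\<close> times
  \<open>e a\<^sup>*\<close> and \<open>e b\<^sup>*\<close> for the first unit vector \<open>e\<close>. The factor \<open>sqrt (x + 1)\<close> is the length of \<open>a\<close> and of
  \<open>b\<close>, so that the moduli are \<open>a a\<^sup>*\<close> and \<open>b b\<^sup>*\<close>, with the diagonal sum \<open>diag (2 x, 2)\<close>: the common range
  of \<open>A\<close> and \<open>B\<close> aligns the phases fully, and the moduli have the eigenvalue ratio \<open>x\<close> at which the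
  quartic inequality is an equality.\<close>
lemma extremal_pair:
  fixes x :: real
  assumes x: "0 < x" and n: "2 \<le> n"
  defines "k \<equiv> complex_of_real (sqrt x)" and "s \<equiv> complex_of_real (sqrt (x + 1))"
  defines "A \<equiv> corner_mat n (s * k) s 0 0" and "B \<equiv> corner_mat n (s * k) (- s) 0 0"
  shows "schatten_norm 4 (A + B) ^ 4 = 16 * (x * (x + 1))\<^sup>2"
    and "schatten_norm 4 (mat_abs A + mat_abs B) ^ 4 = 16 * (x ^ 4 + 1)"
proof -
  have kk: "k * k = complex_of_real x" and ss: "s * s = k * k + 1" and cnj: "cnj k = k" "cnj s = s"
    using x by (simp_all add: k_def s_def of_real_mult[symmetric] del: of_real_mult)
  have AB: "A + B = corner_mat n (2 * (s * k)) 0 0 0"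
    by (simp add: A_def B_def corner_mat_add mult.commute)
  have "mat_adjoint (A + B) * (A + B) = corner_mat n (complex_of_real (4 * (x * (x + 1)))) 0 0 0"
  proof -
    have "2 * (s * k) * (2 * (s * k)) = 4 * ((k * k) * (s * s))" by (simp add: algebra_simps)
    then show ?thesis
      unfolding AB corner_mat_adjoint using n kk ss cnj by (simp add: corner_mat_mult)
  qed
  then show "schatten_norm 4 (A + B) ^ 4 = 16 * (x * (x + 1))\<^sup>2"
    using schatten_norm_4[of "A + B" n] corner_mat_frobenius[OF n, of "complex_of_real (4 * (x * (x + 1)))" 0] x
    by (simp add: A_def B_def norm_mult power_mult_distrib del: of_real_mult of_real_add)
  \<comment> \<open>The sign \<open>e\<close> treats \<open>A\<close> and \<open>B\<close> at once.\<close>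
  have abs: "mat_abs (corner_mat n (s * k) (e * s) 0 0) = corner_mat n (k * k) (e * k) (e * k) 1"
    if e: "e * e = 1" "cnj e = e" for e
  proof -
    have ek: "e * k * (e * k) = k * k" using e(1) by (metis mult.assoc mult.commute mult_1)
    have GG: "mat_adjoint (corner_mat n k e 0 0) * corner_mat n k e 0 0 = corner_mat n (k * k) (e * k) (e * k) 1"
      unfolding corner_mat_adjoint using n e cnj by (simp add: corner_mat_mult mult.commute)
    have 1: "s * k * (s * k) = k * k * (k * k) + e * k * (e * k)"
      and 2: "s * k * (e * s) = k * k * (e * k) + e * k * 1"
      and 3: "e * s * (e * s) = e * k * (e * k) + 1 * 1"
    proof -
      have "s * k * (s * k) = (s * s) * (k * k)" "s * k * (e * s) = (s * s) * (e * k)"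
        "e * s * (e * s) = (e * e) * (s * s)"
        by (simp_all only: ac_simps)
      then show "s * k * (s * k) = k * k * (k * k) + e * k * (e * k)"
        "s * k * (e * s) = k * k * (e * k) + e * k * 1" "e * s * (e * s) = e * k * (e * k) + 1 * 1"
        unfolding ek ss e(1) distrib_right by (simp_all only: mult_1 mult_1_right)
    qed
    have "mat_adjoint (corner_mat n (s * k) (e * s) 0 0) * corner_mat n (s * k) (e * s) 0 0
        = corner_mat n (k * k) (e * k) (e * k) 1 * corner_mat n (k * k) (e * k) (e * k) 1"
      unfolding corner_mat_adjoint corner_mat_mult[OF n]
      using 1 2 3 e cnj by (simp add: mult.commute)
    then show ?thesis
      unfolding GG[symmetric] by (intro mat_abs_eqI[of _ n]) simp_all
  qed
  have "mat_abs A = corner_mat n (k * k) k k 1" "mat_abs B = corner_mat n (k * k) (- k) (- k) 1"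
    using abs[of 1] abs[of "- 1"] by (simp_all add: A_def B_def)
  then have N: "mat_abs A + mat_abs B = corner_mat n (complex_of_real (2 * x)) 0 0 2"
    by (simp add: corner_mat_add kk)
  show "schatten_norm 4 (mat_abs A + mat_abs B) ^ 4 = 16 * (x ^ 4 + 1)"
    unfolding N schatten_norm_4[OF corner_mat_carrier] corner_mat_adjoint
    using n x by (simp add: corner_mat_mult corner_mat_frobenius norm_mult power_mult_distrib power2_eq_square power4_eq_xxxx)
qed

section \<open>The sharp constant\<close>

lemma tz_const_4_2:
  fixes x :: real
  assumes x: "1 < x" "x ^ 4 = 2 * x + 1"
  shows "tz_const 4 2 ^ 4 = x\<^sup>2 * (x + 1) / 2"
proof -
  have p4: "y powr 4 = y ^ 4" if "1 < y" for y :: real using that powr_realpow[of y 4] by simp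
  have "1 < x \<and> x powr 4 - 2 * x - (real 2 - 1) = 0" using x p4 by simp
  then have root: "tz_root 4 2 = x"
    unfolding tz_root_def by (intro the1_equality tz_root_ex1) auto
  have "sqrt (x * (1 + x)) ^ 4 = (x * (x + 1))\<^sup>2"
    using x power_mult[of "sqrt (x * (1 + x))" 2 2] by (simp add: add.commute)
  moreover have "((x ^ 4 + 1) powr (1 / 4)) ^ 4 = 2 * (x + 1)"
    using quarter_powr_power_4[of "x ^ 4 + 1"] x by simp
  ultimately have "tz_const 4 2 ^ 4 = (x * (x + 1))\<^sup>2 / (2 * (x + 1))"
    using x by (simp add: tz_const_def root p4 power_divide add.commute)
  also have "\<dots> = x\<^sup>2 * (x + 1) / 2" using x by (simp add: power2_eq_square field_simps)
  finally show ?thesis .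
qed

theorem theorem1p3:
  fixes x :: real
  assumes "1 < x" and "x ^ 4 - 2 * x - 1 = 0"
  shows "(\<forall>n\<ge>1. \<forall>A\<in>carrier_mat n n. \<forall>B\<in>carrier_mat n n.
            schatten_norm 4 (A + B) ^ 4
              \<le> x\<^sup>2 * (x + 1) / 2 * schatten_norm 4 (mat_abs A + mat_abs B) ^ 4)
    \<and> Sup {schatten_norm 4 (A + B) ^ 4 / schatten_norm 4 (mat_abs A + mat_abs B) ^ 4 | n A B.
            1 \<le> n \<and> A \<in> carrier_mat n n \<and> B \<in> carrier_mat n n \<and> (A, B) \<noteq> (0\<^sub>m n n, 0\<^sub>m n n)}
        = x\<^sup>2 * (x + 1) / 2
    \<and> (\<forall>n\<ge>2. \<exists>A\<in>carrier_mat n n. \<exists>B\<in>carrier_mat n n. (A, B) \<noteq> (0\<^sub>m n n, 0\<^sub>m n n)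
          \<and> schatten_norm 4 (A + B) ^ 4 / schatten_norm 4 (mat_abs A + mat_abs B) ^ 4
              = x\<^sup>2 * (x + 1) / 2)
    \<and> x\<^sup>2 * (x + 1) / 2 = tz_const 4 2 ^ 4"
proof -
  define c where "c = x\<^sup>2 * (x + 1) / 2"
  have x: "1 < x" "x ^ 4 = 2 * x + 1" using assms by simp_all
  have c0: "0 \<le> c" using x by (simp add: c_def)
  have bound: "schatten_norm 4 (A + B) ^ 4 \<le> c * schatten_norm 4 (mat_abs A + mat_abs B) ^ 4"
    if "A \<in> carrier_mat n n" "B \<in> carrier_mat n n" for n A B
    unfolding c_def by (rule schatten_4_bound[OF x that])
  have attained: "\<exists>A\<in>carrier_mat n n. \<exists>B\<in>carrier_mat n n. (A, B) \<noteq> (0\<^sub>m n n, 0\<^sub>m n n)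
      \<and> schatten_norm 4 (A + B) ^ 4 / schatten_norm 4 (mat_abs A + mat_abs B) ^ 4 = c"
    if n: "2 \<le> n" for n
  proof -
    define k where "k = complex_of_real (sqrt x)"
    define s where "s = complex_of_real (sqrt (x + 1))"
    define A where "A = corner_mat n (s * k) s 0 0"
    define B where "B = corner_mat n (s * k) (- s) 0 0"
    have "A $$ (0, 0) \<noteq> 0" using n x by (simp add: A_def corner_mat_def k_def s_def)
    then have "A \<noteq> 0\<^sub>m n n" using n by auto
    moreover have "16 * (x * (x + 1))\<^sup>2 / (16 * (x ^ 4 + 1)) = c"
      using x by (simp add: c_def power2_eq_square field_simps)
    then have "schatten_norm 4 (A + B) ^ 4 / schatten_norm 4 (mat_abs A + mat_abs B) ^ 4 = c"
      using extremal_pair[of x n] x n unfolding A_def B_def k_def s_def by simp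
    ultimately show ?thesis by (intro bexI[of _ A] bexI[of _ B]) (auto simp: A_def B_def)
  qed
  have "Sup {schatten_norm 4 (A + B) ^ 4 / schatten_norm 4 (mat_abs A + mat_abs B) ^ 4 | n A B.
      1 \<le> n \<and> A \<in> carrier_mat n n \<and> B \<in> carrier_mat n n \<and> (A, B) \<noteq> (0\<^sub>m n n, 0\<^sub>m n n)} = c"
    (is "Sup ?R = c")
  proof (rule cSup_eq_maximum)
    obtain A B where "A \<in> carrier_mat 2 2" "B \<in> carrier_mat 2 2" "(A, B) \<noteq> (0\<^sub>m 2 2, 0\<^sub>m 2 2)"
      "c = schatten_norm 4 (A + B) ^ 4 / schatten_norm 4 (mat_abs A + mat_abs B) ^ 4"
      using attained[of 2] by force
    then show "c \<in> ?R" by (intro CollectI exI[of _ 2] exI[of _ A] exI[of _ B]) simp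
  next
    fix t assume "t \<in> ?R"
    then obtain n A B where AB: "A \<in> carrier_mat n n" "B \<in> carrier_mat n n"
      and t: "t = schatten_norm 4 (A + B) ^ 4 / schatten_norm 4 (mat_abs A + mat_abs B) ^ 4" by blast
    \<comment> \<open>A vanishing denominator is harmless: the quotient is then 0 by convention.\<close>
    show "t \<le> c"
    proof (cases "schatten_norm 4 (mat_abs A + mat_abs B) = 0")
      case True
      then show ?thesis using c0 t by simp
    next
      case False
      then have "0 < schatten_norm 4 (mat_abs A + mat_abs B) ^ 4" by (simp add: zero_less_power_eq)
      then show ?thesis unfolding t using bound[OF AB] by (simp add: pos_divide_le_eq)
    qed
  qed
  then show ?thesis using bound attained tz_const_4_2[OF x] by (auto simp: c_def)
qed

end
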